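(* Let $\hat\gamma_{(i)}=G_{(i)}\hat\gamma_{MRE}$ and $\hat\gamma_{(j)}=G_{(j)}\hat\gamma_{MRE}$ be two generalized stochastic restricted estimators of $\gamma$ in the regression model misspecified by excluding relevant variables. Put $D_{(i,j)}=D(\hat\gamma_{(i)})-D(\hat\gamma_{(j)})$, $b_{(i)}=Bias(\hat\gamma_{(i)})$ and $b_{(j)}=Bias(\hat\gamma_{(j)})$. If $D_{(i,j)}$ is positive definite, then $\hat\gamma_{(j)}$ is superior to $\hat\gamma_{(i)}$ in the MSEM sense (that is, $MSEM(\hat\gamma_{(i)})-MSEM(\hat\gamma_{(j)})\ge 0$) if and only if $$b_{(j)}'\left(D_{(i,j)}+b_{(i)}b_{(i)}'\right)^{-1}b_{(j)}\le 1 .$$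
   Context: The true regression model is $y=X_1\beta_1+X_2\beta_2+\varepsilon=X_1\beta_1+\delta+\varepsilon$ with $\delta=X_2\beta_2$, where $y$ is an $n\times 1$ random vector, $X_1$ ($n\times l$) and $X_2$ ($n\times p$) are non-random matrices, $\beta_1$ ($l\times1$) and $\beta_2$ ($p\times 1$) are unknown fixed vectors, $E(\varepsilon)=0$ and $E(\varepsilon\varepsilon')=\sigma^2 I$, $\sigma^2>0$. The researcher misspecifies the model, excluding $X_2$, as $y=X_1\beta_1+u$ (so $u=\delta+\varepsilon$). Prior information is given as $r=R\beta_1+g+v$, where $r$ is $q\times1$, $R$ is a given $q\times l$ matrix of rank $q$, $g$ is a fixed unknown $q\times 1$ vector, $E(v)=0$, $E(vv')=\Psi=\sigma^2W$ with $W$ positive definite, and $E(vu')=0$. The matrix $X_1'X_1$ is positive definite. Let $B$ be a nonsingular $l\times l$ matrix with $B'X_1'X_1B=I$ and $B'R'\Psi^{-1}RB=\Lambda$, $\Lambda$ diagonal with diagonal entries $\lambda_1,\dots,\lambda_q>0$ and $\lambda_{q+1}=\dots=\lambda_l=0$. Put $X_*=X_1B$, $R_*=RB$, $\gamma=B^{-1}\beta_1$, so $y=X_*\gamma+\delta+\varepsilon$ and $r=R_*\gamma+g+v$. The mixed regression estimator is $\hat\gamma_{MRE}=(I+\sigma^2\Lambda)^{-1}(X_*'y+R_*'W^{-1}r)$. A generalized stochastic restricted estimator is $\hat\gamma_{(j)}=G_{(j)}\hat\gamma_{MRE}$ with $G_{(j)}$ a non-random non-negative definite (possibly positive definite) $l\times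 l$ matrix; it represents the estimators with $G_{(j)}$ equal to $I$, $(1+k)^{-1}I$, $(1+k)^{-2}(1+2k)I$, $2^{-1}(1+d)I$, $2^{-2}(1+d)(3-d)I$, $T_hT_h'$, $(1+k)^{-1}T_hT_h'$, $2^{-1}(1+d)T_hT_h'$, where $k>0$, $0<d<1$ and $T_h$ consists of the first $h$ columns of an orthogonal matrix of eigenvectors of $X_1'X_1$. For an estimator $\hat\gamma$ of $\gamma$: $Bias(\hat\gamma)=E(\hat\gamma)-\gamma$, $D(\hat\gamma)$ is its dispersion (covariance) matrix, and $MSEM(\hat\gamma)=E(\hat\gamma-\gamma)(\hat\gamma-\gamma)'=D(\hat\gamma)+Bias(\hat\gamma)Bias(\hat\gamma)'$. For symmetric matrices, $M\ge0$ means $M$ is non-negative definite. *)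

theory Defs
  imports "HOL-Probability.Probability"
begin

definition pos_def_mat :: "real^'n^'n \<Rightarrow> bool" where
  "pos_def_mat A \<longleftrightarrow> transpose A = A \<and> (\<forall>x. x \<noteq> 0 \<longrightarrow> x \<bullet> (A *v x) > 0)"

definition nonneg_def_mat :: "real^'n^'n \<Rightarrow> bool" where
  "nonneg_def_mat A \<longleftrightarrow> transpose A = A \<and> (\<forall>x. x \<bullet> (A *v x) \<ge> 0)"

definition outer_prod :: "real^'m \<Rightarrow> real^'n \<Rightarrow> real^'n^'m" where
  "outer_prod x y = (\<chi> i j. x $ i * y $ j)"

text \<open>
  The Bochner integral of a non-integrable function is 0 by convention. Square integrability
  of a random vector ensures that its mean and second-moment matrix, and the cross-moment
  matrix of any two such vectors, are genuine expectations.
\<close>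
definition sq_integrable :: "'a measure \<Rightarrow> ('a \<Rightarrow> real^'n) \<Rightarrow> bool" where
  "sq_integrable M Z \<longleftrightarrow> Z \<in> borel_measurable M \<and> integrable M (\<lambda>\<omega>. (norm (Z \<omega>))\<^sup>2)"

definition bias :: "'a measure \<Rightarrow> ('a \<Rightarrow> real^'n) \<Rightarrow> real^'n \<Rightarrow> real^'n" where
  "bias M est \<theta> = integral\<^sup>L M est - \<theta>"

definition dispersion :: "'a measure \<Rightarrow> ('a \<Rightarrow> real^'n) \<Rightarrow> real^'n^'n" where
  "dispersion M est =
     integral\<^sup>L M (\<lambda>\<omega>. outer_prod (est \<omega> - integral\<^sup>L M est) (est \<omega> - integral\<^sup>L M est))"

definition msem :: "'a measure \<Rightarrow> ('a \<Rightarrow> real^'n) \<Rightarrow> real^'n \<Rightarrow> real^'n^'n" where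
  "msem M est \<theta> = integral\<^sup>L M (\<lambda>\<omega>. outer_prod (est \<omega> - \<theta>) (est \<omega> - \<theta>))"

definition mre ::
  "real \<Rightarrow> real^'l^'l \<Rightarrow> real^'l^'n \<Rightarrow> real^'l^'q \<Rightarrow> real^'q^'q \<Rightarrow>
   ('a \<Rightarrow> real^'n) \<Rightarrow> ('a \<Rightarrow> real^'q) \<Rightarrow> 'a \<Rightarrow> real^'l" where
  "mre \<sigma> \<Lambda> Xs Rs W y r =
     (\<lambda>\<omega>. matrix_inv (mat 1 + \<sigma>\<^sup>2 *\<^sub>R \<Lambda>) *v
           (transpose Xs *v y \<omega> + transpose Rs *v (matrix_inv W *v r \<omega>)))"

end

theory Submission
  imports Defs
begin

text \<open>
  Square integrability passes from the errors to the estimators, so the mean square error matrix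
  splits into dispersion plus squared bias. Hence the difference of the two matrices is
  \<open>A - b b'\<close> with \<open>b\<close> the second bias and \<open>A\<close> positive definite. Testing \<open>A - b b' \<ge> 0\<close> on
  \<open>z = A\<^sup>-\<^sup>1 b\<close> gives \<open>t - t\<^sup>2 \<ge> 0\<close> for \<open>t = b' A\<^sup>-\<^sup>1 b\<close>; conversely, expanding the form of \<open>A\<close> at
  \<open>x - (b' x) z\<close> bounds \<open>(b' x)\<^sup>2\<close> by \<open>x' A x\<close> as soon as \<open>t \<le> 1\<close>.
\<close>

section \<open>Outer products and symmetric matrices\<close>

lemma bounded_bilinear_outer_prod:
  "bounded_bilinear (outer_prod :: real^'m \<Rightarrow> real^'n \<Rightarrow> real^'n^'m)"
  unfolding bilinear_conv_bounded_bilinear[symmetric] bilinear_def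
  by (auto intro!: linearI simp: outer_prod_def vec_eq_iff algebra_simps)

lemma transpose_outer_prod: "transpose (outer_prod x y) = outer_prod y x"
  by (simp add: transpose_def outer_prod_def vec_eq_iff)

lemma outer_prod_mult_vec: "outer_prod x y *v z = (y \<bullet> z) *\<^sub>R x"
  by (simp add: outer_prod_def matrix_vector_mult_def vec_eq_iff inner_vec_def
      sum_distrib_left mult_ac)

lemma symmetric_mat_inner_commute:
  fixes A :: "real^'n^'n"
  assumes "transpose A = A"
  shows "x \<bullet> (A *v y) = y \<bullet> (A *v x)"
  by (metis assms dot_lmul_matrix inner_commute transpose_matrix_vector)

section \<open>Positive definite matrices and rank-one changes\<close>

lemma matrix_inv_right:
  assumes "invertible A"
  shows "A ** matrix_inv A = mat 1"
  using someI_ex[OF assms[unfolded invertible_def]] by (simp add: matrix_inv_def)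

text \<open>\<open>A *v x = 0\<close> makes the quadratic form vanish at \<open>x\<close>, so the
  kernel is trivial.\<close>

lemma pos_def_mat_invertible: "pos_def_mat A \<Longrightarrow> invertible A"
  unfolding invertible_left_inverse matrix_left_invertible_ker pos_def_mat_def
  by (metis inner_zero_right less_irrefl)

text \<open>The added form is \<open>(b \<bullet> x)\<^sup>2\<close>, which is nonnegative. This
  makes the matrix inverted in the criterion positive definite.\<close>

lemma pos_def_mat_add_outer_prod:
  assumes "pos_def_mat A"
  shows "pos_def_mat (A + outer_prod b b)"
proof -
  have "transpose (A + outer_prod b b) = A + outer_prod b b"
    using assms transpose_outer_prod[of b b]
    by (simp add: pos_def_mat_def transpose_def vec_eq_iff)
  moreover have "x \<bullet> ((A + outer_prod b b) *v x) > 0" if "x \<noteq> 0" for x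
    using assms that
    by (simp add: pos_def_mat_def matrix_vector_mult_add_rdistrib outer_prod_mult_vec
        inner_add_right inner_commute[of x b] add_pos_nonneg)
  ultimately show ?thesis
    by (simp add: pos_def_mat_def)
qed

lemma nonneg_def_mat_diff_outer_prod_iff:
  assumes "pos_def_mat A"
  shows "nonneg_def_mat (A - outer_prod b b) \<longleftrightarrow> b \<bullet> (matrix_inv A *v b) \<le> 1"
proof -
  define z where "z = matrix_inv A *v b"
  define t where "t = b \<bullet> z"
  have sym: "transpose A = A"
    using assms by (simp add: pos_def_mat_def)
  have nn: "x \<bullet> (A *v x) \<ge> 0" for x
    using assms by (cases "x = 0") (auto simp: pos_def_mat_def less_imp_le)
  have Az: "A *v z = b"
    using pos_def_mat_invertible[OF assms]
    by (simp add: z_def matrix_vector_mul_assoc matrix_inv_right)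
  have form: "x \<bullet> ((A - outer_prod b b) *v x) = x \<bullet> (A *v x) - (b \<bullet> x)\<^sup>2" for x
    by (simp add: matrix_vector_mult_diff_rdistrib outer_prod_mult_vec inner_diff_right
        inner_commute[of x b] power2_eq_square)
  have symd: "transpose (A - outer_prod b b) = A - outer_prod b b"
    using sym transpose_outer_prod[of b b] by (simp add: transpose_def vec_eq_iff)
  have zAz: "z \<bullet> (A *v z) = t"
    by (simp add: Az t_def inner_commute)
  have "nonneg_def_mat (A - outer_prod b b) \<longleftrightarrow> t \<le> 1"
  proof
    assume "nonneg_def_mat (A - outer_prod b b)"
    then have "t - t\<^sup>2 \<ge> 0"
      using form[of z] zAz by (metis nonneg_def_mat_def t_def)
    then have "t * t \<le> 1 * t"
      by (simp add: power2_eq_square)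
    \<comment> \<open>Cancelling \<open>t\<close> requires \<open>t > 0\<close>. Since
      \<open>t\<close> is the form of \<open>A\<close> at \<open>z\<close>, it is nonnegative, and
      \<open>t = 0\<close> satisfies the bound anyway.\<close>
    then show "t \<le> 1"
      using nn[of z] zAz by (metis le_cases mult_le_cancel_right not_less order_trans zero_le_one)
  next
    assume t: "t \<le> 1"
    have "x \<bullet> (A *v x) - (b \<bullet> x)\<^sup>2 \<ge> 0" for x
    proof -
      \<comment> \<open>The form of \<open>A\<close> at \<open>x - c z\<close> is smallest for
        \<open>c = s / t\<close>. The choice \<open>c = s\<close> avoids dividing by
        \<open>t\<close>, which may be 0, and is good enough because
        \<open>t \<le> 1\<close>.\<close>
      define s where "s = b \<bullet> x"
      have xAz: "x \<bullet> (A *v z) = s" and zAx: "z \<bullet> (A *v x) = s"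
        using symmetric_mat_inner_commute[OF sym, of x z] by (simp_all add: Az s_def inner_commute)
      have "0 \<le> (x - s *\<^sub>R z) \<bullet> (A *v (x - s *\<^sub>R z))"
        by (rule nn)
      also have "\<dots> = x \<bullet> (A *v x) - 2 * s\<^sup>2 + s\<^sup>2 * t"
        by (simp add: matrix_vector_mult_diff_distrib matrix_vector_mult_scaleR inner_diff_left
            inner_diff_right xAz zAx zAz power2_eq_square algebra_simps)
      also have "\<dots> \<le> x \<bullet> (A *v x) - s\<^sup>2"
        using mult_left_mono[OF t, of "s\<^sup>2"] by simp
      finally show ?thesis
        by (simp add: s_def)
    qed
    then show "nonneg_def_mat (A - outer_prod b b)"
      by (simp add: nonneg_def_mat_def symd form)
  qed
  then show ?thesis
    by (simp add: t_def z_def)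
qed

section \<open>Closure of square integrability under sums and linear maps\<close>

lemma sq_integrable_add:
  assumes "sq_integrable M X" "sq_integrable M Y"
  shows "sq_integrable M (\<lambda>\<omega>. X \<omega> + Y \<omega>)"
proof -
  have [measurable]: "X \<in> borel_measurable M" "Y \<in> borel_measurable M"
    using assms by (auto simp: sq_integrable_def)
  have "integrable M (\<lambda>\<omega>. (norm (X \<omega> + Y \<omega>))\<^sup>2)"
  proof (rule Bochner_Integration.integrable_bound)
    show "integrable M (\<lambda>\<omega>. 2 * (norm (X \<omega>))\<^sup>2 + 2 * (norm (Y \<omega>))\<^sup>2)"
      using assms by (simp add: sq_integrable_def)
    \<comment> \<open>By the parallelogram law the two sides differ by exactly
      \<open>(norm (a - b))\<^sup>2\<close>.\<close>
    have "(norm (a + b))\<^sup>2 \<le> 2 * (norm a)\<^sup>2 + 2 * (norm b)\<^sup>2" for a b :: "real^'b"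
      using zero_le_power2[of "norm (a - b)"]
      by (simp add: power2_norm_eq_inner inner_add_left inner_add_right inner_diff_left
          inner_diff_right inner_commute)
    then show "AE \<omega> in M. norm ((norm (X \<omega> + Y \<omega>))\<^sup>2)
        \<le> norm (2 * (norm (X \<omega>))\<^sup>2 + 2 * (norm (Y \<omega>))\<^sup>2)"
      by simp
  qed measurable
  then show ?thesis
    by (simp add: sq_integrable_def)
qed

lemma sq_integrable_mult_vec:
  fixes A :: "real^'m^'n"
  assumes "sq_integrable M X"
  shows "sq_integrable M (\<lambda>\<omega>. A *v X \<omega>)"
proof -
  have X [measurable]: "X \<in> borel_measurable M"
    using assms by (auto simp: sq_integrable_def)
  have [measurable]: "(\<lambda>\<omega>. A *v X \<omega>) \<in> borel_measurable M"
    by (rule measurable_compose[OF X])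
      (intro borel_measurable_continuous_onI linear_continuous_on matrix_vector_mul_bounded_linear)
  obtain K where K: "\<And>x. norm (A *v x) \<le> norm x * K"
    using bounded_linear.bounded[OF matrix_vector_mul_bounded_linear[of A]] by blast
  have "integrable M (\<lambda>\<omega>. (norm (A *v X \<omega>))\<^sup>2)"
  proof (rule Bochner_Integration.integrable_bound)
    show "integrable M (\<lambda>\<omega>. (norm (X \<omega>))\<^sup>2 * K\<^sup>2)"
      using assms by (simp add: sq_integrable_def)
    show "AE \<omega> in M. norm ((norm (A *v X \<omega>))\<^sup>2) \<le> norm ((norm (X \<omega>))\<^sup>2 * K\<^sup>2)"
      using power_mono[OF K norm_ge_zero, of _ 2] by (simp add: power_mult_distrib)
  qed measurable
  then show ?thesis
    by (simp add: sq_integrable_def)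
qed

section \<open>Moments under a probability measure\<close>

context prob_space
begin

lemma sq_integrable_const: "sq_integrable M (\<lambda>\<omega>. c)"
  by (simp add: sq_integrable_def)

lemma sq_integrable_imp_integrable:
  assumes "sq_integrable M X"
  shows "integrable M X"
proof (rule Bochner_Integration.integrable_bound)
  show "integrable M (\<lambda>\<omega>. 1 + (norm (X \<omega>))\<^sup>2)"
    using assms by (simp add: sq_integrable_def)
  \<comment> \<open>Expanding \<open>(norm x - 1/2)\<^sup>2 \<ge> 0\<close> gives this even with 1/4
    in place of 1.\<close>
  have "norm x \<le> 1 + (norm x)\<^sup>2" for x :: "real^'b"
    using sum_power2_ge_zero[of "norm x - 1/2" 0] by (simp add: power2_eq_square algebra_simps)
  then show "AE \<omega> in M. norm (X \<omega>) \<le> norm (1 + (norm (X \<omega>))\<^sup>2)"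
    by simp
qed (use assms in \<open>simp add: sq_integrable_def\<close>)

lemma integrable_outer_prod_self:
  fixes X :: "'a \<Rightarrow> real^'n"
  assumes "sq_integrable M X"
  shows "integrable M (\<lambda>\<omega>. outer_prod (X \<omega>) (X \<omega>))"
proof -
  have X: "X \<in> borel_measurable M"
    using assms by (auto simp: sq_integrable_def)
  obtain K where K: "\<And>x y. norm (outer_prod (x :: real^'n) (y :: real^'n)) \<le> norm x * norm y * K"
    using bounded_bilinear.bounded[OF bounded_bilinear_outer_prod] by blast
  show ?thesis
  proof (rule Bochner_Integration.integrable_bound)
    show "integrable M (\<lambda>\<omega>. (norm (X \<omega>))\<^sup>2 * K)"
      using assms by (simp add: sq_integrable_def)
    show "(\<lambda>\<omega>. outer_prod (X \<omega>) (X \<omega>)) \<in> borel_measurable M"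
      by (rule measurable_compose[OF X], intro borel_measurable_continuous_onI
          bounded_bilinear.continuous_on[OF bounded_bilinear_outer_prod] continuous_on_id)
    \<comment> \<open>The sign of \<open>K\<close> is left open, so the bound passes through an
      absolute value.\<close>
    show "AE \<omega> in M. norm (outer_prod (X \<omega>) (X \<omega>)) \<le> norm ((norm (X \<omega>))\<^sup>2 * K)"
      using order_trans[OF K abs_ge_self] by (simp add: power2_eq_square)
  qed
qed

text \<open>The error \<open>X - \<theta>\<close> is the centred vector \<open>Z\<close> plus the
  constant bias \<open>b\<close>. In the expanded outer product the two cross terms have mean
  zero.\<close>

lemma msem_eq_dispersion_add_bias:
  fixes X :: "'a \<Rightarrow> real^'n"
  assumes "sq_integrable M X"
  shows "msem M X \<theta> = dispersion M X + outer_prod (bias M X \<theta>) (bias M X \<theta>)"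
proof -
  interpret outer: bounded_bilinear "outer_prod :: real^'n \<Rightarrow> real^'n \<Rightarrow> real^'n^'n"
    by (rule bounded_bilinear_outer_prod)
  define Z where "Z = (\<lambda>\<omega>. X \<omega> - expectation X)"
  define b where "b = bias M X \<theta>"
  have Z: "sq_integrable M Z"
    using sq_integrable_add[OF assms sq_integrable_const[of "- expectation X"]]
    by (simp add: Z_def)
  have int: "integrable M Z"
    using Z by (rule sq_integrable_imp_integrable)
  have Z0: "expectation Z = 0"
    using sq_integrable_imp_integrable[OF assms] by (simp add: Z_def prob_space)
  have "outer_prod (X \<omega> - \<theta>) (X \<omega> - \<theta>)
      = outer_prod (Z \<omega>) (Z \<omega>) + (outer_prod (Z \<omega>) b + (outer_prod b (Z \<omega>) + outer_prod b b))"
    for \<omega>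
  proof -
    have "X \<omega> - \<theta> = Z \<omega> + b"
      by (simp add: Z_def b_def bias_def)
    then show ?thesis
      by (simp add: outer.add_left outer.add_right)
  qed
  then have "msem M X \<theta> = expectation (\<lambda>\<omega>. outer_prod (Z \<omega>) (Z \<omega>)
      + (outer_prod (Z \<omega>) b + (outer_prod b (Z \<omega>) + outer_prod b b)))"
    by (simp add: msem_def)
  \<comment> \<open>With one argument fixed at \<open>b\<close> the outer product is bounded linear,
    so it commutes with the expectation. The constant term keeps its value because the total mass is
    1.\<close>
  also have "\<dots> = expectation (\<lambda>\<omega>. outer_prod (Z \<omega>) (Z \<omega>)) + (outer_prod (expectation Z) b
      + (outer_prod b (expectation Z) + outer_prod b b))"
    using integrable_outer_prod_self[OF Z] int
      integrable_bounded_linear[OF outer.bounded_linear_left int, of b]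
      integrable_bounded_linear[OF outer.bounded_linear_right int, of b]
    by (simp add: prob_space integral_bounded_linear[OF outer.bounded_linear_left int]
        integral_bounded_linear[OF outer.bounded_linear_right int])
  finally show ?thesis
    by (simp only: Z0) (simp add: outer.zero_left outer.zero_right dispersion_def Z_def b_def)
qed

text \<open>The estimator is a fixed matrix applied to a sum of linear images of \<open>y\<close>
  and \<open>r\<close>.\<close>

lemma sq_integrable_mre:
  assumes "sq_integrable M y" "sq_integrable M r"
  shows "sq_integrable M (mre \<sigma> \<Lambda> Xs Rs W y r)"
  unfolding mre_def by (intro sq_integrable_mult_vec sq_integrable_add assms)

end

theorem theorem1:
  fixes M :: "'a measure"
    and X1 :: "real^'l^'n" and X2 :: "real^'p^'n" and R Rs :: "real^'l^'q"
    and \<beta>1 \<gamma> :: "real^'l" and \<beta>2 :: "real^'p" and \<delta> :: "real^'n" and g :: "real^'q"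
    and \<sigma> :: real and W \<Psi> :: "real^'q^'q" and B \<Lambda> :: "real^'l^'l" and Xs :: "real^'l^'n"
    and y \<epsilon> u :: "'a \<Rightarrow> real^'n" and r v :: "'a \<Rightarrow> real^'q"
    and e :: "nat \<Rightarrow> 'l"
    and Gi Gj Dij :: "real^'l^'l" and \<gamma>MRE \<gamma>i \<gamma>j :: "'a \<Rightarrow> real^'l" and bi bj :: "real^'l"
  assumes "prob_space M"
    \<comment> \<open>true model\<close>
    and "\<delta> = X2 *v \<beta>2"
    and "y = (\<lambda>\<omega>. X1 *v \<beta>1 + \<delta> + \<epsilon> \<omega>)"
    and "sq_integrable M \<epsilon>"
    and "integral\<^sup>L M \<epsilon> = 0"
    and "\<sigma>\<^sup>2 > 0"
    and "integral\<^sup>L M (\<lambda>\<omega>. outer_prod (\<epsilon> \<omega>) (\<epsilon> \<omega>)) = \<sigma>\<^sup>2 *\<^sub>R mat 1"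
    \<comment> \<open>error of the misspecified model \<open>y = X1 \<beta>1 + u\<close>\<close>
    and "u = (\<lambda>\<omega>. y \<omega> - X1 *v \<beta>1)"
    \<comment> \<open>prior information\<close>
    and "r = (\<lambda>\<omega>. R *v \<beta>1 + g + v \<omega>)"
    and "rank R = CARD('q)"
    and "sq_integrable M v"
    and "integral\<^sup>L M v = 0"
    and "pos_def_mat W"
    and "\<Psi> = \<sigma>\<^sup>2 *\<^sub>R W"
    and "integral\<^sup>L M (\<lambda>\<omega>. outer_prod (v \<omega>) (v \<omega>)) = \<Psi>"
    and "integral\<^sup>L M (\<lambda>\<omega>. outer_prod (v \<omega>) (u \<omega>)) = 0"
    and "pos_def_mat (transpose X1 ** X1)"
    \<comment> \<open>canonical form; \<open>e\<close> lists the coordinates in the order 1, ..., l\<close>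
    and "invertible B"
    and "transpose B ** transpose X1 ** X1 ** B = mat 1"
    and "transpose B ** transpose R ** matrix_inv \<Psi> ** R ** B = \<Lambda>"
    and "bij_betw e {1..CARD('l)} UNIV"
    and "\<forall>a b. a \<noteq> b \<longrightarrow> \<Lambda> $ a $ b = 0"
    and "\<forall>k\<in>{1..CARD('q)}. \<Lambda> $ e k $ e k > 0"
    and "\<forall>k\<in>{CARD('q)<..CARD('l)}. \<Lambda> $ e k $ e k = 0"
    and "Xs = X1 ** B" and "Rs = R ** B" and "\<gamma> = matrix_inv B *v \<beta>1"
    \<comment> \<open>the two generalized estimators\<close>
    and "\<gamma>MRE = mre \<sigma> \<Lambda> Xs Rs W y r"
    and "nonneg_def_mat Gi" and "nonneg_def_mat Gj"
    and "\<gamma>i = (\<lambda>\<omega>. Gi *v \<gamma>MRE \<omega>)" and "\<gamma>j = (\<lambda>\<omega>. Gj *v \<gamma>MRE \<omega>)"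
    and "Dij = dispersion M \<gamma>i - dispersion M \<gamma>j"
    and "bi = bias M \<gamma>i \<gamma>" and "bj = bias M \<gamma>j \<gamma>"
    and "pos_def_mat Dij"
  shows "nonneg_def_mat (msem M \<gamma>i \<gamma> - msem M \<gamma>j \<gamma>) \<longleftrightarrow>
         bj \<bullet> (matrix_inv (Dij + outer_prod bi bi) *v bj) \<le> 1"
proof -
  interpret prob_space M by fact
  have "sq_integrable M y" "sq_integrable M r"
    unfolding \<open>y = _\<close> \<open>r = _\<close>
    using \<open>sq_integrable M \<epsilon>\<close> \<open>sq_integrable M v\<close>
    by (auto intro!: sq_integrable_add sq_integrable_const)
  then have "sq_integrable M \<gamma>i" "sq_integrable M \<gamma>j"
    unfolding \<open>\<gamma>i = _\<close> \<open>\<gamma>j = _\<close> \<open>\<gamma>MRE = _\<close>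
    by (auto intro!: sq_integrable_mult_vec sq_integrable_mre)
  \<comment> \<open>Grouping the first squared bias with \<open>Dij\<close> leaves a positive
    definite matrix minus a single rank-one term, the shape that the matrix criterion
    treats.\<close>
  then have "msem M \<gamma>i \<gamma> - msem M \<gamma>j \<gamma> = (Dij + outer_prod bi bi) - outer_prod bj bj"
    by (simp add: msem_eq_dispersion_add_bias \<open>Dij = _\<close> \<open>bi = _\<close> \<open>bj = _\<close>)
  then show ?thesis
    using nonneg_def_mat_diff_outer_prod_iff[OF pos_def_mat_add_outer_prod[OF \<open>pos_def_mat Dij\<close>]]
    by simp
qed

end
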